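(* Let $g$ be a global state, $p,q\in\mathcal{PV}$ and $\Gamma\subseteq\mathcal{A}$. If $\phi\in\{\langle\langle\Gamma\rangle\rangle\mathrm{X}\,p,\ \langle\langle\Gamma\rangle\rangle\mathrm{G}\,p,\ \langle\langle\Gamma\rangle\rangle\,p\,\mathrm{U}\,q\}$, then the predicate $Model_{g,\phi}(\mathcal{V}_M)$ is negative monotonic with respect to $TB_i$ for $i\in\mathcal{A}\setminus\Gamma$.
   Context: Fix a set of agents $\mathcal{A}=\{1,\dots,n\}$, a finite set $\mathcal{PV}$ of propositional variables, and for each agent $i$ a finite set of local states $L_i=\{l_i^1,\dots,l_i^{n_i}\}$. Agent $i$ has actions $Act_i=\{a_i^1,\dots,a_i^{n_i}\}$ and a local protocol $P_i:L_i\to 2^{Act_i}$ with $P_i(l)\neq\emptyset$ for all $l$; its local transition function is $T_i(l_i^k,a_i^j)=l_i^j$, defined iff $a_i^j\in P_i(l_i^k)$. A model is $M=(St,T,V)$ with $St=L_1\times\dots\times L_n$, global actions $Act=Act_1\times\dots\times Act_n$, global transition $T(g,a)=g'$ iff $T_i(g^i,a^i)=g'^i$ for all $i$ (superscript $i$ denotes the $i$-th component), and valuation $V:St\to 2^{\mathcal{PV}}$. Encoding: $P_i$ is a Boolean $n_i\times n_i$ table (entry $(l,a)$ is $1$ iff $a\in P_i(l)$) flattened into $tb_i$; $V$ is a bit vector $vb$ of length $|St|\cdot|\mathcal{PV}|$ (entry $(g,p)$ is $1$ iff $p\in V(g)$). The model is encoded by $v_M=(tb_1,\dots,tb_n,vb)$;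 $\mathcal{V}_M=(TB_1,\dots,TB_n,VB)$ is the corresponding vector of Boolean variables; only vectors encoding models (each local state has at least one available action, i.e. each row of each table contains a $1$) are considered. A path from $g$ is $g_0a_0g_1a_1\dots$ with $g_0=g$, $T(g_k,a_k)=g_{k+1}$; $\pi[k]=g_k$. A strategy of agent $i$ is $\sigma_i:St\to Act_i$ with $\sigma_i(g)\in P_i(g^i)$; a joint strategy $\sigma_\Gamma$ is a tuple of strategies of agents in $\Gamma$; $out_M(g,\sigma_\Gamma)$ is the set of paths from $g$ with $a_k^j=\sigma_j(g_k)$ for all $k$ and $j\in\Gamma$. $M,g\models\langle\langle\Gamma\rangle\rangle\mathrm{X}\varphi$ iff there is $\sigma_\Gamma$ with $out_M(g,\sigma_\Gamma)\neq\emptyset$ and $M,\pi[1]\models\varphi$ for every $\pi$ in it; $M,g\models\langle\langle\Gamma\rangle\rangle\varphi_1\mathrm{U}\varphi_2$ iff there is $\sigma_\Gamma$ with nonempty outcome such that every $\pi$ in it has $i\ge0$ with $M,\pi[i]\models\varphi_2$ and $M,\pi[j]\models\varphi_1$ for $j<i$; $M,g\models\langle\langle\Gamma\rangle\rangle\mathrm{G}\varphi$ iff there is $\sigma_\Gamma$ with nonempty outcome such that $M,\pi[i]\models\varphi$ for all $i\ge 0$ and all $\pi$ in it; $M,g\models p$ iff $p\in V(g)$. $Model_{g,\phi}(v_M)=1$ iff $M,g\models\phi$ for the model $M$ encoded by $v_M$. A predicate on bit vectors is negative monotonic w.r.t. a set $W$ of its variables if changing any single variable of $W$ from $1$ to $0$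 (others fixed, staying within the considered vectors) preserves the value $1$. *)

theory Defs
  imports Main "HOL-Library.FuncSet"
begin

type_synonym agent = nat

text \<open>The local state \<open>l_i^k\<close> and the local action \<open>a_i^k\<close> of agent \<open>i\<close> are both represented by
  their index \<open>k \<in> {1..n_i}\<close>.\<close>

type_synonym lstate = nat
type_synonym lact = nat
type_synonym gstate = "agent \<Rightarrow> lstate"
type_synonym gact = "agent \<Rightarrow> lact"

record 'p mas_sig =
  num_agents :: nat
  num_local :: "agent \<Rightarrow> nat"
  props :: "'p set"

definition agents :: "'p mas_sig \<Rightarrow> agent set" where
  "agents S = {1..num_agents S}"

definition lstates :: "'p mas_sig \<Rightarrow> agent \<Rightarrow> lstate set" where
  "lstates S i = {1..num_local S i}"

definition lacts :: "'p mas_sig \<Rightarrow> agent \<Rightarrow> lact set" where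
  "lacts S i = {1..num_local S i}"

definition gstates :: "'p mas_sig \<Rightarrow> gstate set" where
  "gstates S = (\<Pi>\<^sub>E i\<in>agents S. lstates S i)"

definition gacts :: "'p mas_sig \<Rightarrow> gact set" where
  "gacts S = (\<Pi>\<^sub>E i\<in>agents S. lacts S i)"

definition wf_sig :: "'p mas_sig \<Rightarrow> bool" where
  "wf_sig S \<longleftrightarrow> 1 \<le> num_agents S \<and> (\<forall>i\<in>agents S. 1 \<le> num_local S i) \<and> finite (props S)"

text \<open>Over a fixed signature, a model is determined by its protocols and its valuation.\<close>

record 'p model =
  prot :: "agent \<Rightarrow> lstate \<Rightarrow> lact set"
  val :: "gstate \<Rightarrow> 'p set"

definition models :: "'p mas_sig \<Rightarrow> 'p model set" where
  "models S = {M. prot M \<in> (\<Pi>\<^sub>E i\<in>agents S. lstates S i \<rightarrow>\<^sub>E (Pow (lacts S i) - {{}})) \<and>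
                  val M \<in> gstates S \<rightarrow>\<^sub>E Pow (props S)}"

definition ltrans :: "'p model \<Rightarrow> agent \<Rightarrow> lstate \<Rightarrow> lact \<Rightarrow> lstate option" where
  "ltrans M i k j = (if j \<in> prot M i k then Some j else None)"

definition gtrans :: "'p mas_sig \<Rightarrow> 'p model \<Rightarrow> gstate \<Rightarrow> gact \<Rightarrow> gstate \<Rightarrow> bool" where
  "gtrans S M g a g' \<longleftrightarrow> g \<in> gstates S \<and> a \<in> gacts S \<and> g' \<in> gstates S \<and>
     (\<forall>i\<in>agents S. ltrans M i (g i) (a i) = Some (g' i))"

text \<open>The path \<open>g\<^sub>0 a\<^sub>0 g\<^sub>1 a\<^sub>1 \<dots>\<close> is the pair of its state and action sequences.\<close>

type_synonym path = "(nat \<Rightarrow> gstate) \<times> (nat \<Rightarrow> gact)"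

definition paths :: "'p mas_sig \<Rightarrow> 'p model \<Rightarrow> gstate \<Rightarrow> path set" where
  "paths S M g = {\<pi>. fst \<pi> 0 = g \<and> (\<forall>k. gtrans S M (fst \<pi> k) (snd \<pi> k) (fst \<pi> (Suc k)))}"

definition strategies :: "'p mas_sig \<Rightarrow> 'p model \<Rightarrow> agent \<Rightarrow> (gstate \<Rightarrow> lact) set" where
  "strategies S M i = (\<Pi>\<^sub>E g\<in>gstates S. prot M i (g i))"

definition joint_strategies ::
  "'p mas_sig \<Rightarrow> 'p model \<Rightarrow> agent set \<Rightarrow> (agent \<Rightarrow> gstate \<Rightarrow> lact) set" where
  "joint_strategies S M \<Gamma> = (\<Pi>\<^sub>E i\<in>\<Gamma>. strategies S M i)"

definition outcome ::
  "'p mas_sig \<Rightarrow> 'p model \<Rightarrow> gstate \<Rightarrow> agent set \<Rightarrow> (agent \<Rightarrow> gstate \<Rightarrow> lact) \<Rightarrow> path set" where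
  "outcome S M g \<Gamma> \<sigma> = {\<pi> \<in> paths S M g. \<forall>k. \<forall>j\<in>\<Gamma>. snd \<pi> k j = \<sigma> j (fst \<pi> k)}"

datatype 'p form =
    Atom 'p
  | CoalX "agent set" "'p form"
  | CoalG "agent set" "'p form"
  | CoalU "agent set" "'p form" "'p form"

primrec sat :: "'p mas_sig \<Rightarrow> 'p model \<Rightarrow> gstate \<Rightarrow> 'p form \<Rightarrow> bool" where
  "sat S M g (Atom p) \<longleftrightarrow> p \<in> val M g"
| "sat S M g (CoalX \<Gamma> \<phi>) \<longleftrightarrow>
     (\<exists>\<sigma>\<in>joint_strategies S M \<Gamma>. outcome S M g \<Gamma> \<sigma> \<noteq> {} \<and>
        (\<forall>\<pi>\<in>outcome S M g \<Gamma> \<sigma>. sat S M (fst \<pi> 1) \<phi>))"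
| "sat S M g (CoalG \<Gamma> \<phi>) \<longleftrightarrow>
     (\<exists>\<sigma>\<in>joint_strategies S M \<Gamma>. outcome S M g \<Gamma> \<sigma> \<noteq> {} \<and>
        (\<forall>\<pi>\<in>outcome S M g \<Gamma> \<sigma>. \<forall>i. sat S M (fst \<pi> i) \<phi>))"
| "sat S M g (CoalU \<Gamma> \<phi>\<^sub>1 \<phi>\<^sub>2) \<longleftrightarrow>
     (\<exists>\<sigma>\<in>joint_strategies S M \<Gamma>. outcome S M g \<Gamma> \<sigma> \<noteq> {} \<and>
        (\<forall>\<pi>\<in>outcome S M g \<Gamma> \<sigma>.
           \<exists>i. sat S M (fst \<pi> i) \<phi>\<^sub>2 \<and> (\<forall>j<i. sat S M (fst \<pi> j) \<phi>\<^sub>1)))"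

text \<open>The Boolean variables carry the table positions as names, \<open>TB i l a\<close> for the entry
  \<open>(l, a)\<close> of the table of agent \<open>i\<close> and \<open>VB g p\<close> for the entry \<open>(g, p)\<close> of the valuation vector,
  instead of a position in a flattened vector. A bit vector is an assignment to
  the variables of the signature, extensional outside of them.\<close>

datatype 'p mvar = TB agent lstate lact | VB gstate 'p

definition TB_vars :: "'p mas_sig \<Rightarrow> agent \<Rightarrow> 'p mvar set" where
  "TB_vars S i = {TB i l a | l a. l \<in> lstates S i \<and> a \<in> lacts S i}"

definition VB_vars :: "'p mas_sig \<Rightarrow> 'p mvar set" where
  "VB_vars S = {VB g p | g p. g \<in> gstates S \<and> p \<in> props S}"

definition model_vars :: "'p mas_sig \<Rightarrow> 'p mvar set" where
  "model_vars S = (\<Union>i\<in>agents S. TB_vars S i) \<union> VB_vars S"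

definition encode :: "'p mas_sig \<Rightarrow> 'p model \<Rightarrow> 'p mvar \<Rightarrow> bool" where
  "encode S M = (\<lambda>x\<in>model_vars S. case x of TB i l a \<Rightarrow> a \<in> prot M i l | VB g p \<Rightarrow> p \<in> val M g)"

definition model_vectors :: "'p mas_sig \<Rightarrow> ('p mvar \<Rightarrow> bool) set" where
  "model_vectors S = encode S ` models S"

text \<open>By \<open>inj_on_encode\<close> below, the model encoded by a vector is unique.\<close>

definition Model_pred :: "'p mas_sig \<Rightarrow> gstate \<Rightarrow> 'p form \<Rightarrow> ('p mvar \<Rightarrow> bool) \<Rightarrow> bool" where
  "Model_pred S g \<phi> v \<longleftrightarrow> (\<exists>M\<in>models S. encode S M = v \<and> sat S M g \<phi>)"

text \<open>\<open>D\<close> is the set of considered vectors.\<close>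

definition neg_monotonic :: "('v \<Rightarrow> bool) set \<Rightarrow> 'v set \<Rightarrow> (('v \<Rightarrow> bool) \<Rightarrow> bool) \<Rightarrow> bool" where
  "neg_monotonic D W F \<longleftrightarrow>
     (\<forall>v\<in>D. \<forall>x\<in>W. v x \<and> v(x := False) \<in> D \<and> F v \<longrightarrow> F (v(x := False)))"

lemma encode_TB:
  "i \<in> agents S \<Longrightarrow> l \<in> lstates S i \<Longrightarrow> a \<in> lacts S i \<Longrightarrow> encode S M (TB i l a) \<longleftrightarrow> a \<in> prot M i l"
  by (auto simp: encode_def model_vars_def TB_vars_def)

lemma encode_VB:
  "g \<in> gstates S \<Longrightarrow> p \<in> props S \<Longrightarrow> encode S M (VB g p) \<longleftrightarrow> p \<in> val M g"
  by (auto simp: encode_def model_vars_def VB_vars_def)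

lemma inj_on_encode: "inj_on (encode S) (models S)"
proof (rule inj_onI)
  fix M N :: "'a model"
  assume M: "M \<in> models S" and N: "N \<in> models S" and eq: "encode S M = encode S N"
  have PM: "prot M \<in> (\<Pi>\<^sub>E i\<in>agents S. lstates S i \<rightarrow>\<^sub>E (Pow (lacts S i) - {{}}))"
    and PN: "prot N \<in> (\<Pi>\<^sub>E i\<in>agents S. lstates S i \<rightarrow>\<^sub>E (Pow (lacts S i) - {{}}))"
    using M N by (simp_all add: models_def)
  have "prot M i l = prot N i l" if "i \<in> agents S" "l \<in> lstates S i" for i l
  proof -
    have "prot M i l \<subseteq> lacts S i" "prot N i l \<subseteq> lacts S i"
      using PiE_mem[OF PiE_mem[OF PM that(1)] that(2)] PiE_mem[OF PiE_mem[OF PN that(1)] that(2)]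
      by auto
    then show ?thesis
      using encode_TB[OF that, of _ M] encode_TB[OF that, of _ N] eq by auto
  qed
  then have "prot M i = prot N i" if "i \<in> agents S" for i
    using that by (intro PiE_ext[OF PiE_mem[OF PM that] PiE_mem[OF PN that]]) auto
  then have 1: "prot M = prot N"
    by (rule PiE_ext[OF PM PN])
  have VM: "val M \<in> gstates S \<rightarrow>\<^sub>E Pow (props S)" and VN: "val N \<in> gstates S \<rightarrow>\<^sub>E Pow (props S)"
    using M N by (simp_all add: models_def)
  have "val M g = val N g" if "g \<in> gstates S" for g
    using PiE_mem[OF VM that] PiE_mem[OF VN that] encode_VB[OF that, of _ M]
      encode_VB[OF that, of _ N] eq by auto
  then have 2: "val M = val N"
    by (rule PiE_ext[OF VM VN])
  show "M = N" using 1 2 by simp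
qed

lemma model_vectors_eq:
  "model_vectors S =
     {v \<in> model_vars S \<rightarrow>\<^sub>E UNIV. \<forall>i\<in>agents S. \<forall>l\<in>lstates S i. \<exists>a\<in>lacts S i. v (TB i l a)}"
  (is "_ = ?R")
proof
  show "model_vectors S \<subseteq> ?R"
  proof
    fix v assume "v \<in> model_vectors S"
    then obtain M where M: "M \<in> models S" and v: "v = encode S M"
      by (auto simp: model_vectors_def)
    have "\<exists>a\<in>lacts S i. v (TB i l a)" if "i \<in> agents S" "l \<in> lstates S i" for i l
    proof -
      have "prot M i l \<in> Pow (lacts S i) - {{}}"
        using M that by (simp add: models_def PiE_iff)
      then show ?thesis
        using encode_TB[OF that, of _ M] v by auto
    qed
    moreover have "v \<in> model_vars S \<rightarrow>\<^sub>E UNIV"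
      by (simp add: v encode_def)
    ultimately show "v \<in> ?R"
      by blast
  qed
  show "?R \<subseteq> model_vectors S"
  proof
    fix v assume v: "v \<in> ?R"
    define M where "M = \<lparr>prot = (\<lambda>i\<in>agents S. \<lambda>l\<in>lstates S i. {a \<in> lacts S i. v (TB i l a)}),
                         val = (\<lambda>g\<in>gstates S. {p \<in> props S. v (VB g p)})\<rparr>"
    have "M \<in> models S"
      using v by (auto simp: models_def M_def) blast
    moreover have "encode S M x = v x" for x
    proof (cases "x \<in> model_vars S")
      case True
      then show ?thesis
        by (auto simp: encode_def model_vars_def TB_vars_def VB_vars_def M_def)
    next
      case False
      moreover have "v \<in> extensional (model_vars S)"
        using v by (simp add: PiE_iff)
      ultimately have "v x = undefined"
        by (intro extensional_arb)
      with False show ?thesis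
        by (simp add: encode_def)
    qed
    then have "v = encode S M"
      by (intro ext) simp
    ultimately show "v \<in> model_vectors S"
      unfolding model_vectors_def by blast
  qed
qed

end

theory Submission
  imports Defs
begin

text \<open>Restricting the protocols of agents outside \<open>\<Gamma>\<close> leaves the strategies of \<open>\<Gamma>\<close> unchanged and
  can only remove paths from the outcome of each of them, while the outcome stays nonempty because
  every local state keeps an available action. So a strategy that witnesses \<open>\<phi>\<close> before the
  restriction still does so afterwards.\<close>

lemma prot_in_models:
  assumes "M \<in> models S" and "j \<in> agents S" and "l \<in> lstates S j"
  shows "prot M j l \<subseteq> lacts S j" and "prot M j l \<noteq> {}"
  using assms by (auto simp: models_def PiE_iff)

lemma gstates_component: "h \<in> gstates S \<Longrightarrow> j \<in> agents S \<Longrightarrow> h j \<in> lstates S j"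
  by (auto simp: gstates_def)

lemma joint_strategy_in_prot:
  assumes "\<sigma> \<in> joint_strategies S M \<Gamma>" and "j \<in> \<Gamma>" and "h \<in> gstates S"
  shows "\<sigma> j h \<in> prot M j (h j)"
  using assms by (auto simp: joint_strategies_def strategies_def PiE_iff)

text \<open>Local choices of available actions combine freely into an enabled global action, so play
  never deadlocks and an infinite path consistent with \<open>\<sigma>\<close> arises by
  iteration.\<close>

lemma outcome_nonempty:
  assumes M: "M \<in> models S" and g: "g \<in> gstates S"
    and \<sigma>: "\<sigma> \<in> joint_strategies S M \<Gamma>" and \<Gamma>: "\<Gamma> \<subseteq> agents S"
  shows "outcome S M g \<Gamma> \<sigma> \<noteq> {}"
proof -
  \<comment> \<open>Opponents pick an arbitrary available action; restricting to
    \<open>agents S\<close> makes the choice extensional, as \<open>gacts\<close> demands.\<close>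
  define act where "act = (\<lambda>h. \<lambda>j\<in>agents S. if j \<in> \<Gamma> then \<sigma> j h else SOME a. a \<in> prot M j (h j))"
  have act_prot: "act h j \<in> prot M j (h j)" if "h \<in> gstates S" "j \<in> agents S" for h j
    using that joint_strategy_in_prot[OF \<sigma>] some_in_eq[of "prot M j (h j)"]
      prot_in_models(2)[OF M _ gstates_component]
    by (simp add: act_def)
  have act_gacts: "act h \<in> gacts S" if "h \<in> gstates S" for h
    unfolding gacts_def
  proof (rule PiE_I)
    show "act h j \<in> lacts S j" if "j \<in> agents S" for j
      using prot_in_models(1)[OF M that gstates_component] act_prot that \<open>h \<in> gstates S\<close> by blast
  qed (simp add: act_def)
  \<comment> \<open>The local action with index \<open>k\<close> leads to the local state with index \<open>k\<close>, so a global action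
    is also its own successor state.\<close>
  have gacts_gstates: "gacts S = gstates S"
    by (simp add: gacts_def gstates_def lacts_def lstates_def)
  have step: "gtrans S M h (act h) (act h)" if "h \<in> gstates S" for h
    using that act_gacts act_prot by (auto simp: gtrans_def ltrans_def gacts_gstates)
  \<comment> \<open>Since \<open>act h\<close> is also the state reached from \<open>h\<close>,
    iterating \<open>act\<close> itself runs through the states of the path.\<close>
  define s where "s = (\<lambda>k. (act ^^ k) g)"
  have s: "s k \<in> gstates S" for k
    by (induction k) (use g act_gacts gacts_gstates in \<open>auto simp: s_def\<close>)
  have "(s, act \<circ> s) \<in> outcome S M g \<Gamma> \<sigma>"
    using step[OF s] \<Gamma> by (auto simp: outcome_def paths_def act_def s_def)
  then show ?thesis by blast
qed

text \<open>A protocol only decides whether an action is enabled, never where it leads, so every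
  step of \<open>N\<close> is the same step in \<open>M\<close>.\<close>

lemma outcome_antimono_prot:
  assumes "\<And>j l. j \<in> agents S \<Longrightarrow> l \<in> lstates S j \<Longrightarrow> prot N j l \<subseteq> prot M j l"
  shows "outcome S N g \<Gamma> \<sigma> \<subseteq> outcome S M g \<Gamma> \<sigma>"
proof -
  have "gtrans S M h a h'" if "gtrans S N h a h'" for h a h'
    using that assms gstates_component
    by (fastforce simp: gtrans_def ltrans_def split: if_splits)
  then show ?thesis
    by (auto simp: outcome_def paths_def)
qed

lemma joint_strategies_cong:
  assumes "\<Gamma> \<subseteq> agents S"
    and "\<And>j l. j \<in> \<Gamma> \<Longrightarrow> l \<in> lstates S j \<Longrightarrow> prot N j l = prot M j l"
  shows "joint_strategies S N \<Gamma> = joint_strategies S M \<Gamma>"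
proof -
  have "prot N j (h j) = prot M j (h j)" if "j \<in> \<Gamma>" "h \<in> gstates S" for j h
    using assms that gstates_component by blast
  then show ?thesis
    unfolding joint_strategies_def strategies_def by (intro PiE_cong) simp
qed

text \<open>With atomic arguments, the condition on a path depends only on the valuation, which both
  models share.\<close>

lemma sat_restrict_opponents:
  assumes N: "N \<in> models S" and g: "g \<in> gstates S" and \<Gamma>: "\<Gamma> \<subseteq> agents S"
    and sub: "\<And>j l. j \<in> agents S \<Longrightarrow> l \<in> lstates S j \<Longrightarrow> prot N j l \<subseteq> prot M j l"
    and eq: "\<And>j l. j \<in> \<Gamma> \<Longrightarrow> l \<in> lstates S j \<Longrightarrow> prot N j l = prot M j l"
    and val: "val N = val M"
    and \<phi>: "\<phi> \<in> {CoalX \<Gamma> (Atom p), CoalG \<Gamma> (Atom p), CoalU \<Gamma> (Atom p) (Atom q)}"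
    and sat: "sat S M g \<phi>"
  shows "sat S N g \<phi>"
proof -
  \<comment> \<open>The three modalities differ only in the path property, so one argument for an
    arbitrary \<open>P\<close> covers them all.\<close>
  have transfer: "\<exists>\<sigma>\<in>joint_strategies S N \<Gamma>. outcome S N g \<Gamma> \<sigma> \<noteq> {} \<and> (\<forall>\<pi>\<in>outcome S N g \<Gamma> \<sigma>. P \<pi>)"
    if win: "\<exists>\<sigma>\<in>joint_strategies S M \<Gamma>. outcome S M g \<Gamma> \<sigma> \<noteq> {} \<and> (\<forall>\<pi>\<in>outcome S M g \<Gamma> \<sigma>. P \<pi>)"
    for P
  proof -
    obtain \<sigma> where \<sigma>: "\<sigma> \<in> joint_strategies S N \<Gamma>" and P: "\<forall>\<pi>\<in>outcome S M g \<Gamma> \<sigma>. P \<pi>"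
      using win joint_strategies_cong[OF \<Gamma> eq] by auto
    have "\<forall>\<pi>\<in>outcome S N g \<Gamma> \<sigma>. P \<pi>"
      using P outcome_antimono_prot[OF sub] by blast
    with \<sigma> outcome_nonempty[OF N g \<sigma> \<Gamma>] show ?thesis by blast
  qed
  show ?thesis
    using \<phi>
  proof (elim insertE emptyE)
    assume \<phi>: "\<phi> = CoalX \<Gamma> (Atom p)"
    show ?thesis
      using sat unfolding \<phi> sat.simps val by (rule transfer)
  next
    assume \<phi>: "\<phi> = CoalG \<Gamma> (Atom p)"
    show ?thesis
      using sat unfolding \<phi> sat.simps val by (rule transfer)
  next
    assume \<phi>: "\<phi> = CoalU \<Gamma> (Atom p) (Atom q)"
    show ?thesis
      using sat unfolding \<phi> sat.simps val by (rule transfer)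
  qed
qed

text \<open>Translates clearing one bit of a vector into the relation between the two encoded models
  that the semantic argument needs.\<close>

lemma encode_flip_TB:
  assumes M: "M \<in> models S" and N: "N \<in> models S"
    and enc: "encode S N = (encode S M)(TB i l a := False)"
  shows "val N = val M"
    and "\<lbrakk>j \<in> agents S; k \<in> lstates S j\<rbrakk> \<Longrightarrow> prot N j k \<subseteq> prot M j k"
    and "\<lbrakk>j \<in> agents S; k \<in> lstates S j; j \<noteq> i\<rbrakk> \<Longrightarrow> prot N j k = prot M j k"
proof -
  have VM: "val M \<in> gstates S \<rightarrow>\<^sub>E Pow (props S)" and VN: "val N \<in> gstates S \<rightarrow>\<^sub>E Pow (props S)"
    using M N by (simp_all add: models_def)
  have "val N h = val M h" if "h \<in> gstates S" for h
    using PiE_mem[OF VM that] PiE_mem[OF VN that] encode_VB[OF that, of _ M]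
      encode_VB[OF that, of _ N] enc by auto
  then show "val N = val M"
    by (rule PiE_ext[OF VN VM])
next
  assume j: "j \<in> agents S" "k \<in> lstates S j"
  have bit: "b \<in> prot N j k \<longleftrightarrow> b \<in> prot M j k \<and> (j, k, b) \<noteq> (i, l, a)" if "b \<in> lacts S j" for b
    using encode_TB[OF j that, of M] encode_TB[OF j that, of N] enc by (auto split: if_splits)
  \<comment> \<open>The vectors only show actions in \<open>lacts S j\<close>; these bounds extend
    \<open>bit\<close> to the whole protocol sets.\<close>
  note acts = prot_in_models(1)[OF M j] prot_in_models(1)[OF N j]
  show "prot N j k \<subseteq> prot M j k"
    using bit acts by blast
  show "prot N j k = prot M j k" if "j \<noteq> i"
    using bit acts that by blast
qed

theorem theorem3p7:
  fixes S :: "'p mas_sig" and g :: gstate and p q :: 'p and \<Gamma> :: "agent set"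
    and \<phi> :: "'p form" and i :: agent
  assumes "wf_sig S"
    and "g \<in> gstates S"
    and "p \<in> props S" and "q \<in> props S"
    and "\<Gamma> \<subseteq> agents S"
    and "\<phi> \<in> {CoalX \<Gamma> (Atom p), CoalG \<Gamma> (Atom p), CoalU \<Gamma> (Atom p) (Atom q)}"
    and "i \<in> agents S - \<Gamma>"
  shows "neg_monotonic (model_vectors S) (TB_vars S i) (Model_pred S g \<phi>)"
  unfolding neg_monotonic_def
proof (intro ballI impI, elim conjE)
  fix v x
  assume "x \<in> TB_vars S i" and D: "v(x := False) \<in> model_vectors S" and F: "Model_pred S g \<phi> v"
  then obtain l a where x: "x = TB i l a"
    by (auto simp: TB_vars_def)
  obtain M where M: "M \<in> models S" "encode S M = v" and sat: "sat S M g \<phi>"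
    using F by (auto simp: Model_pred_def)
  \<comment> \<open>Staying within the considered vectors guarantees that the cleared row still
    contains a 1, hence a model \<open>N\<close>.\<close>
  obtain N where N: "N \<in> models S" "encode S N = v(x := False)"
    using D by (auto simp: model_vectors_def)
  note flip = encode_flip_TB[OF M(1) N(1), of i l a, unfolded M(2) N(2) x, OF refl]
  \<comment> \<open>As \<open>i\<close> lies outside \<open>\<Gamma>\<close>, the tables of all
    members of \<open>\<Gamma>\<close> are untouched.\<close>
  have "sat S N g \<phi>"
    by (rule sat_restrict_opponents[OF N(1) assms(2,5) flip(2) _ flip(1) assms(6) sat])
      (use assms(5,7) flip(3) in auto)
  with N show "Model_pred S g \<phi> (v(x := False))"
    by (auto simp: Model_pred_def)
qed

end
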